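(* Let $m>0$, $\omega>0$, and let $s,\ell$ be nonnegative integers with $\ell\ge s$. Let $T$ be the greybody factor (transmission probability) at frequency $\omega$ for the Regge--Wheeler potential $V$ of a Schwarzschild black hole of mass $m$, spin $s$ and angular momentum $\ell$ (defined in the context), and let $V_{\mathrm{peak}}=\max_{r\in(2m,\infty)}V(r)$. If $\omega^2>V_{\mathrm{peak}}$, then $$T\ge\frac{4\omega^2(\omega^2-V_{\mathrm{peak}})}{(2\omega^2-V_{\mathrm{peak}})^2}=1-\frac{V_{\mathrm{peak}}^2}{(2\omega^2-V_{\mathrm{peak}})^2}.$$
   Context: Units $G=c=1$. The tortoise coordinate $r_*\in(-\infty,\infty)$ is $r_*=r+2m\ln\frac{r-2m}{2m}$ for $r\in(2m,\infty)$, so that $dr/dr_*=1-2m/r$. The Regge--Wheeler equation is $\frac{d^2\psi}{dr_*^2}+[\omega^2-V(r)]\psi=0$ with $V(r)=\left(1-\frac{2m}{r}\right)\left[\frac{\ell(\ell+1)}{r^2}+\frac{2m(1-s^2)}{r^3}\right]$, where $r=r(r_* )$. The greybody factor $T$ is the transmission probability of this one-dimensional scattering problem on $r_*\in\mathbb{R}$: if the solution with $\psi\sim e^{i\omega r_*}$ as $r_*\to-\infty$ behaves as $\psi\sim\alpha e^{i\omega r_*}+\beta e^{-i\omega r_*}$ as $r_*\to+\infty$, then $T=1/|\alpha|^2$. *)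

theory Defs
  imports "HOL-Analysis.Analysis"
begin

definition tortoise :: "real \<Rightarrow> real \<Rightarrow> real" where
  "tortoise m r = r + 2 * m * ln ((r - 2 * m) / (2 * m))"

definition radius :: "real \<Rightarrow> real \<Rightarrow> real" where
  "radius m = inv_into {2 * m<..} (tortoise m)"

definition RW_potential :: "real \<Rightarrow> nat \<Rightarrow> nat \<Rightarrow> real \<Rightarrow> real" where
  "RW_potential m s l r =
     (1 - 2 * m / r) * (real l * (real l + 1) / r ^ 2 + 2 * m * (1 - (real s)\<^sup>2) / r ^ 3)"

definition V_peak :: "real \<Rightarrow> nat \<Rightarrow> nat \<Rightarrow> real" where
  "V_peak m s l = (GREATEST v. v \<in> RW_potential m s l ` {2 * m<..})"

definition RW_solution :: "real \<Rightarrow> nat \<Rightarrow> nat \<Rightarrow> real \<Rightarrow> (real \<Rightarrow> complex) \<Rightarrow> bool" where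
  "RW_solution m s l \<omega> \<psi> \<longleftrightarrow>
     (\<exists>\<psi>' \<psi>''. \<forall>x.
        (\<psi> has_vector_derivative \<psi>' x) (at x) \<and>
        (\<psi>' has_vector_derivative \<psi>'' x) (at x) \<and>
        \<psi>'' x + of_real (\<omega>\<^sup>2 - RW_potential m s l (radius m x)) * \<psi> x = 0)"

text \<open>Asymptotic relations are read as convergence of the difference to 0; since the potential
  tends to 0 at both ends, the differential equation makes the first derivatives match as well.\<close>

definition scattering_solution ::
  "real \<Rightarrow> nat \<Rightarrow> nat \<Rightarrow> real \<Rightarrow> (real \<Rightarrow> complex) \<Rightarrow> complex \<Rightarrow> complex \<Rightarrow> bool" where
  "scattering_solution m s l \<omega> \<psi> \<alpha> \<beta> \<longleftrightarrow>
     RW_solution m s l \<omega> \<psi> \<and>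
     ((\<lambda>x. \<psi> x - exp (\<i> * of_real (\<omega> * x))) \<longlongrightarrow> 0) at_bot \<and>
     ((\<lambda>x. \<psi> x - (\<alpha> * exp (\<i> * of_real (\<omega> * x)) + \<beta> * exp (- \<i> * of_real (\<omega> * x))))
        \<longlongrightarrow> 0) at_top"

definition is_greybody_factor :: "real \<Rightarrow> nat \<Rightarrow> nat \<Rightarrow> real \<Rightarrow> real \<Rightarrow> bool" where
  "is_greybody_factor m s l \<omega> T \<longleftrightarrow>
     (\<exists>\<psi> \<alpha> \<beta>. scattering_solution m s l \<omega> \<psi> \<alpha> \<beta> \<and> T = 1 / (cmod \<alpha>)\<^sup>2)"

text \<open>The next two facts justify the inverse and the maximum used above.\<close>

lemma tortoise_bij:
  assumes "m > 0"
  shows "bij_betw (tortoise m) {2 * m<..} UNIV"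
proof -
  have mono: "tortoise m x < tortoise m y" if "2 * m < x" "x < y" for x y
  proof -
    have "ln ((x - 2 * m) / (2 * m)) < ln ((y - 2 * m) / (2 * m))"
      using that assms by (subst ln_less_cancel_iff) (auto simp: divide_strict_right_mono)
    then have "2 * m * ln ((x - 2 * m) / (2 * m)) < 2 * m * ln ((y - 2 * m) / (2 * m))"
      using assms by simp
    then show ?thesis using that by (simp add: tortoise_def)
  qed
  have inj: "inj_on (tortoise m) {2 * m<..}"
    by (rule linorder_inj_onI') (use mono in force)
  have surj: "\<exists>r>2 * m. tortoise m r = y" for y
  proof -
    define a where "a = 2 * m + 2 * m * exp (- \<bar>y\<bar> / (2 * m) - 2)"
    define b where "b = 4 * m + \<bar>y\<bar>"
    have "0 \<le> \<bar>y\<bar> / (2 * m)"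
      using assms by simp
    then have "- \<bar>y\<bar> / (2 * m) - 2 \<le> 0"
      unfolding minus_divide_left[symmetric] by linarith
    then have "2 * m * exp (- \<bar>y\<bar> / (2 * m) - 2) \<le> 2 * m * 1"
      using assms by (intro mult_left_mono) auto
    then have ab: "2 * m < a" "a \<le> 4 * m"
      using assms by (auto simp: a_def)
    have "ln ((a - 2 * m) / (2 * m)) = - \<bar>y\<bar> / (2 * m) - 2"
      using assms by (simp add: a_def)
    then have "tortoise m a = a - \<bar>y\<bar> - 4 * m"
      using assms by (simp add: tortoise_def right_diff_distrib)
    then have a: "tortoise m a \<le> y"
      using ab by linarith
    have "ln ((b - 2 * m) / (2 * m)) \<ge> 0"
      using assms by (simp add: b_def)
    then have "b \<le> tortoise m b"
      using assms by (simp add: tortoise_def)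
    then have b: "y \<le> tortoise m b"
      using assms by (simp add: b_def)
    have "a \<le> b"
      using ab(2) by (simp add: b_def)
    moreover have "continuous_on {a..b} (tortoise m)"
      unfolding tortoise_def using assms ab by (auto intro!: continuous_intros)
    ultimately obtain r where "a \<le> r" "tortoise m r = y"
      using IVT'[of "tortoise m" a y b] a b by auto
    then show ?thesis
      using ab(1) by (intro exI[of _ r]) auto
  qed
  have "y \<in> tortoise m ` {2 * m<..}" for y
    using surj[of y] by auto
  then show ?thesis
    unfolding bij_betw_def using inj by blast
qed

lemma V_peak_attained:
  assumes "m > 0" "s \<le> l"
  shows "\<exists>r>2 * m. RW_potential m s l r = V_peak m s l"
    and "r > 2 * m \<Longrightarrow> RW_potential m s l r \<le> V_peak m s l"
proof -
  let ?V = "RW_potential m s l"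
  have "real l * (real l + 1) \<ge> real s * (real s + 1)"
    using assms by (intro mult_mono) auto
  moreover have "real s * (real s + 1) = (real s)\<^sup>2 + real s" "(real s)\<^sup>2 \<ge> 0" "real s \<ge> 0"
    by (simp_all add: power2_eq_square distrib_left)
  ultimately have "3 * (real l * (real l + 1)) + 2 - 2 * (real s)\<^sup>2 > 0"
    by linarith
  then have "0 < (3 * (real l * (real l + 1)) + 2 - 2 * (real s)\<^sup>2) / (81 * m\<^sup>2)"
    using assms by simp
  also have "\<dots> = ?V (3 * m)"
    using assms by (simp add: RW_potential_def power_mult_distrib power2_eq_square power3_eq_cube divide_simps)
  finally have "?V (3 * m) > 0" .
  moreover have "(?V \<longlongrightarrow> 0) at_top"
  proof -
    have lim: "((\<lambda>r. c / r ^ n) \<longlongrightarrow> 0) at_top" if "n > 0" for c :: real and n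
      by (rule tendsto_divide_0[OF tendsto_const], rule filterlim_at_top_imp_at_infinity,
          rule filterlim_pow_at_top[OF that filterlim_ident])
    have "((\<lambda>r. (1 - 2 * m / r ^ 1) *
        (real l * (real l + 1) / r ^ 2 + 2 * m * (1 - (real s)\<^sup>2) / r ^ 3)) \<longlongrightarrow> (1 - 0) * (0 + 0)) at_top"
      by (rule tendsto_mult[OF tendsto_diff[OF tendsto_const lim] tendsto_add[OF lim lim]]) simp_all
    then show ?thesis
      by (simp add: RW_potential_def[abs_def])
  qed
  ultimately have "eventually (\<lambda>r. ?V r < ?V (3 * m)) at_top"
    by (blast intro: order_tendstoD(2))
  then obtain B where B: "\<And>r. r \<ge> B \<Longrightarrow> ?V r < ?V (3 * m)"
    by (auto simp: eventually_at_top_linorder)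
  have "3 * m \<le> B" using B[of "3 * m"] by (meson less_irrefl linear)
  have "continuous_on {2 * m..B} ?V"
    unfolding RW_potential_def using assms by (auto intro!: continuous_intros)
  then obtain p where p: "p \<in> {2 * m..B}" "\<And>r. r \<in> {2 * m..B} \<Longrightarrow> ?V r \<le> ?V p"
    using continuous_attains_sup[of "{2 * m..B}" ?V] \<open>3 * m \<le> B\<close> assms by auto
  have p3: "?V (3 * m) \<le> ?V p" using p(2)[of "3 * m"] \<open>3 * m \<le> B\<close> assms by auto
  have "?V (2 * m) = 0" using assms by (simp add: RW_potential_def)
  then have "p \<noteq> 2 * m" using p3 \<open>?V (3 * m) > 0\<close> by auto
  then have p2: "p > 2 * m" using p(1) by auto
  have le: "?V r \<le> ?V p" if "r > 2 * m" for r
    using p(2)[of r] B[of r] p3 that by (cases "r \<le> B") auto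
  have "V_peak m s l = ?V p"
    unfolding V_peak_def by (rule Greatest_equality) (use p2 le in auto)
  then show "\<exists>r>2 * m. ?V r = V_peak m s l" "r > 2 * m \<Longrightarrow> ?V r \<le> V_peak m s l"
    using p2 le by auto
qed

end

(* Put Q = omega^2 - V and E = |psi'|^2 + Q |psi|^2. Conservation of the flux
   Im (cnj psi psi') = omega makes S = sqrt (E^2 - 4 omega^2 Q) real, and it follows that E + S
   decreases where V increases while E - S increases where V decreases. Since V has a single hump
   and (E + S) (E - S) = 4 omega^2 Q, comparing the two ends of the line through the peak gives
   c - sqrt (c^2 - 4 omega^4) >= 2 Q_peak for c = lim E = 2 omega^2 (2 |alpha|^2 - 1) at +infinity;
   solving this for |alpha|^2 is the bound. *)

theory Submission
  imports Defs
begin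

section \<open>Asymptotics of scattering solutions at both ends of the line\<close>

text \<open>An interpolation bound of Landau type. On the unit interval \<open>f'\<close> varies by
  at most \<open>3 * e\<close>, so \<open>f (x+1) - f x\<close>, itself of norm at most
  \<open>2 * e\<close>, differs from \<open>f' x\<close> by at most \<open>3 * e\<close>. The
  constant 5 is not sharp; any fixed constant serves.\<close>

lemma norm_derivative_le_of_second_derivative:
  fixes f :: "real \<Rightarrow> 'a::real_normed_vector"
  assumes f: "\<And>t. t \<in> {x..x+1} \<Longrightarrow> (f has_vector_derivative f' t) (at t)"
    and f': "\<And>t. t \<in> {x..x+1} \<Longrightarrow> (f' has_vector_derivative f'' t) (at t)"
    and bf: "\<And>t. t \<in> {x..x+1} \<Longrightarrow> norm (f t) \<le> e"
    and bf'': "\<And>t. t \<in> {x..x+1} \<Longrightarrow> norm (f'' t) \<le> e"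
  shows "norm (f' x) \<le> 5 * e"
proof -
  have b: "norm (f' t - f' x) \<le> 3 * e" if t: "t \<in> {x..x+1}" for t
  proof -
    \<comment> \<open>The remainder of the linearization is controlled by the oscillation of
      \<open>f''\<close>, hence \<open>2 * e\<close>; the linear term adds another
      \<open>e\<close>.\<close>
    have "norm (f' t - f' x - (t - x) *\<^sub>R f'' x) \<le> norm (t - x) * (2 * e)"
    proof (rule vector_differentiable_bound_linearization[where S = "{x..x+1}"])
      show "(f' has_vector_derivative f'' u) (at u within {x..x+1})" if "u \<in> {x..x+1}" for u
        using f'[OF that] by (rule has_vector_derivative_at_within)
      show "norm (f'' u - f'' x) \<le> 2 * e" if "u \<in> {x..x+1}" for u
        using norm_triangle_ineq4[of "f'' u" "f'' x"] bf''[OF that] bf''[of x] by simp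
    qed (use t in \<open>auto simp: closed_segment_eq_real_ivl\<close>)
    also have "\<dots> \<le> 1 * (2 * e)"
      using t order_trans[OF norm_ge_zero bf[OF t]] by (intro mult_right_mono) auto
    finally have 1: "norm (f' t - f' x - (t - x) *\<^sub>R f'' x) \<le> 2 * e" by simp
    have "norm ((t - x) *\<^sub>R f'' x) \<le> 1 * e"
      unfolding norm_scaleR using t bf''[of x] by (intro mult_mono) auto
    with 1 show ?thesis
      using norm_triangle_ineq[of "f' t - f' x - (t - x) *\<^sub>R f'' x" "(t - x) *\<^sub>R f'' x"] by simp
  qed
  have "norm (f (x+1) - f x - ((x+1) - x) *\<^sub>R f' x) \<le> norm ((x+1) - x) * (3 * e)"
  proof (rule vector_differentiable_bound_linearization[where S = "{x..x+1}"])
    show "(f has_vector_derivative f' u) (at u within {x..x+1})" if "u \<in> {x..x+1}" for u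
      using f[OF that] by (rule has_vector_derivative_at_within)
  qed (use b in \<open>auto simp: closed_segment_eq_real_ivl\<close>)
  then have "norm (f (x+1) - f x - f' x) \<le> 3 * e" by simp
  moreover have "norm (f (x+1) - f x) \<le> 2 * e"
    using norm_triangle_ineq4[of "f (x+1)" "f x"] bf[of x] bf[of "x+1"] by simp
  ultimately show ?thesis
    using norm_triangle_ineq4[of "f (x+1) - f x" "f (x+1) - f x - f' x"] by simp
qed

lemma eventually_unit_interval_right:
  fixes P :: "real \<Rightarrow> bool"
  assumes "F = at_bot \<or> F = at_top" and "eventually P F"
  shows "eventually (\<lambda>x. \<forall>t\<in>{x..x+1}. P t) F"
  using assms(1)
proof
  assume F: "F = at_bot"
  then obtain N where N: "\<And>n. n \<le> N \<Longrightarrow> P n"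
    using assms(2) by (auto simp: eventually_at_bot_linorder)
  show ?thesis
    \<comment> \<open>Towards minus infinity the threshold moves left by 1, so that the right end
      \<open>x+1\<close> still lies below \<open>N\<close>.\<close>
    unfolding F eventually_at_bot_linorder by (rule exI[of _ "N - 1"]) (auto intro!: N)
next
  assume F: "F = at_top"
  then obtain N where N: "\<And>n. n \<ge> N \<Longrightarrow> P n"
    using assms(2) by (auto simp: eventually_at_top_linorder)
  show ?thesis
    unfolding F eventually_at_top_linorder by (rule exI[of _ N]) (auto intro!: N)
qed

text \<open>The scattering conditions constrain only the solution itself; this passes the
  convergence on to the first derivative, which energy and flux involve.\<close>

lemma derivative_tendsto_zero:
  fixes f :: "real \<Rightarrow> 'a::real_normed_vector"
  assumes F: "F = at_bot \<or> F = at_top"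
    and f: "\<And>t. (f has_vector_derivative f' t) (at t)"
    and f': "\<And>t. (f' has_vector_derivative f'' t) (at t)"
    and lim: "(f \<longlongrightarrow> 0) F" "(f'' \<longlongrightarrow> 0) F"
  shows "(f' \<longlongrightarrow> 0) F"
proof (rule tendstoI)
  fix e :: real
  assume e: "e > 0"
  \<comment> \<open>The interpolation bound loses a factor 5, so any fraction of \<open>e\<close>
    below one fifth works.\<close>
  have "eventually (\<lambda>t. norm (f t) < e / 6 \<and> norm (f'' t) < e / 6) F"
    using tendstoD[OF lim(1), of "e/6"] tendstoD[OF lim(2), of "e/6"] e
    by (auto intro: eventually_conj)
  from eventually_unit_interval_right[OF F this]
  show "eventually (\<lambda>x. dist (f' x) 0 < e) F"
  proof eventually_elim
    case (elim x)
    have "norm (f' x) \<le> 5 * (e / 6)"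
      by (rule norm_derivative_le_of_second_derivative[OF f f']) (use elim in \<open>auto intro: less_imp_le\<close>)
    with e show ?case by simp
  qed
qed

text \<open>Although \<open>\<psi>\<close> oscillates, the moduli of
  \<open>\<psi>' + \<i> * \<omega> * \<psi>\<close> and
  \<open>\<psi>' - \<i> * \<omega> * \<psi>\<close> converge, since each combination retains only
  one of the two plane waves. Energy and flux are expressed through these moduli.\<close>

lemma scattering_asymptotics:
  fixes \<psi> \<psi>' \<psi>'' :: "real \<Rightarrow> complex" and V :: "real \<Rightarrow> real"
  assumes F: "F = at_bot \<or> F = at_top" and \<omega>: "\<omega> > 0"
    and d: "\<And>x. (\<psi> has_vector_derivative \<psi>' x) (at x)"
    and d': "\<And>x. (\<psi>' has_vector_derivative \<psi>'' x) (at x)"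
    and ode: "\<And>x. \<psi>'' x + of_real (\<omega>\<^sup>2 - V x) * \<psi> x = 0"
    and V: "(V \<longlongrightarrow> 0) F"
    and lim: "((\<lambda>x. \<psi> x - (\<alpha> * exp (\<i> * of_real (\<omega> * x)) + \<beta> * exp (- \<i> * of_real (\<omega> * x)))) \<longlongrightarrow> 0) F"
  shows "((\<lambda>x. (cmod (\<psi>' x))\<^sup>2 + (\<omega>\<^sup>2 - V x) * (cmod (\<psi> x))\<^sup>2) \<longlongrightarrow> 2 * \<omega>\<^sup>2 * ((cmod \<alpha>)\<^sup>2 + (cmod \<beta>)\<^sup>2)) F"
    and "((\<lambda>x. Im (cnj (\<psi> x) * \<psi>' x)) \<longlongrightarrow> \<omega> * ((cmod \<alpha>)\<^sup>2 - (cmod \<beta>)\<^sup>2)) F"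
proof -
  define e :: "real \<Rightarrow> complex" where "e x = exp (\<i> * of_real (\<omega> * x))" for x
  define e1 :: "real \<Rightarrow> complex" where "e1 x = exp (- \<i> * of_real (\<omega> * x))" for x
  \<comment> \<open>The deviation from the plane waves. In its second derivative the sign is plus
    because both waves satisfy \<open>e'' = - \<omega>^2 e\<close>.\<close>
  define f where "f x = \<psi> x - (\<alpha> * e x + \<beta> * e1 x)" for x
  define f' where "f' x = \<psi>' x - \<i> * \<omega> * (\<alpha> * e x - \<beta> * e1 x)" for x
  define f'' where "f'' x = \<psi>'' x + \<omega>\<^sup>2 * (\<alpha> * e x + \<beta> * e1 x)" for x
  have ee: "e x * e1 x = 1" for x
    by (simp add: e_def e1_def exp_add[symmetric])
  have ne: "cmod (e x) = 1" "cmod (e1 x) = 1" for x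
    by (simp_all add: e_def e1_def)
  have cmod_diff_tendsto: "((\<lambda>x. cmod (g x) - cmod (h x)) \<longlongrightarrow> 0) F"
    if "((\<lambda>x. g x - h x) \<longlongrightarrow> 0) F" for g h :: "real \<Rightarrow> complex"
    by (rule Lim_null_comparison[OF _ tendsto_norm_zero[OF that]]) (simp add: norm_triangle_ineq3)
  have de: "(e has_vector_derivative \<i> * \<omega> * e x) (at x)" for x
    unfolding e_def by (rule derivative_eq_intros has_vector_derivative_real_field refl | simp)+
  have de1: "(e1 has_vector_derivative - \<i> * \<omega> * e1 x) (at x)" for x
    unfolding e1_def by (rule derivative_eq_intros has_vector_derivative_real_field refl | simp)+
  have f: "(f has_vector_derivative f' x) (at x)" for x
    unfolding f_def f'_def
    by (rule derivative_eq_intros d de de1 refl | simp add: algebra_simps)+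
  have f': "(f' has_vector_derivative f'' x) (at x)" for x
    unfolding f'_def f''_def
    by (rule derivative_eq_intros d' de de1 refl | simp add: algebra_simps power2_eq_square)+
  have lim_f: "(f \<longlongrightarrow> 0) F"
    using lim unfolding f_def[abs_def] e_def e1_def .
  have bu: "Bfun (\<lambda>x. \<alpha> * e x + \<beta> * e1 x) F"
  proof (rule BfunI, rule always_eventually, rule allI)
    show "norm (\<alpha> * e x + \<beta> * e1 x) \<le> cmod \<alpha> + cmod \<beta>" for x
      using norm_triangle_ineq[of "\<alpha> * e x" "\<beta> * e1 x"] by (simp add: norm_mult ne)
  qed
  have cV: "((\<lambda>x. of_real (V x) :: complex) \<longlongrightarrow> 0) F"
    using tendsto_of_real[OF V, where 'a = complex] by simp
  \<comment> \<open>The waves have no limit, but they are bounded, and null times bounded is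
    null.\<close>
  have Vu: "((\<lambda>x. of_real (V x) * (\<alpha> * e x + \<beta> * e1 x)) \<longlongrightarrow> 0) F"
    using bounded_bilinear.Zfun_prod_Bfun[OF bounded_bilinear_mult _ bu] cV
    by (simp add: tendsto_Zfun_iff)
  have V\<psi>: "((\<lambda>x. of_real (V x) * \<psi> x) \<longlongrightarrow> 0) F"
    using tendsto_add[OF Vu tendsto_mult[OF cV lim_f]] by (simp add: f_def algebra_simps)
  \<comment> \<open>The equation turns \<open>f''\<close> into a combination of null functions,
    which is what the derivative lemma requires.\<close>
  have f''_eq: "f'' x = of_real (V x) * \<psi> x - \<omega>\<^sup>2 * f x" for x
    using ode[of x] by (simp add: f''_def f_def algebra_simps eq_neg_iff_add_eq_0)
  have lim_f'': "(f'' \<longlongrightarrow> 0) F"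
    unfolding f''_eq using tendsto_diff[OF V\<psi> tendsto_mult[OF tendsto_const lim_f]] by simp
  have lim_f': "(f' \<longlongrightarrow> 0) F"
    by (rule derivative_tendsto_zero[OF F f f' lim_f lim_f''])
  \<comment> \<open>Inserting the waves for \<open>\<psi>\<close>, \<open>P\<close> becomes
    \<open>2 * \<i> * \<omega> * \<alpha> * e\<close> and \<open>N\<close> becomes
    \<open>- 2 * \<i> * \<omega> * \<beta> * e1\<close>.\<close>
  define P where "P x = \<psi>' x + \<i> * \<omega> * \<psi> x" for x
  define N where "N x = \<psi>' x - \<i> * \<omega> * \<psi> x" for x
  have "((\<lambda>x. f' x + \<i> * \<omega> * f x) \<longlongrightarrow> 0) F" "((\<lambda>x. f' x - \<i> * \<omega> * f x) \<longlongrightarrow> 0) F"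
    using tendsto_add[OF lim_f' tendsto_mult[OF tendsto_const lim_f]]
      tendsto_diff[OF lim_f' tendsto_mult[OF tendsto_const lim_f]] by simp_all
  then have "((\<lambda>x. P x - 2 * \<i> * \<omega> * \<alpha> * e x) \<longlongrightarrow> 0) F"
    and "((\<lambda>x. N x - (- 2 * \<i> * \<omega> * \<beta> * e1 x)) \<longlongrightarrow> 0) F"
    by (simp_all add: P_def N_def f_def f'_def algebra_simps)
  note this[THEN cmod_diff_tendsto]
  then have nP: "((\<lambda>x. cmod (P x)) \<longlongrightarrow> 2 * \<omega> * cmod \<alpha>) F"
    and nN: "((\<lambda>x. cmod (N x)) \<longlongrightarrow> 2 * \<omega> * cmod \<beta>) F"
    using \<omega> by (simp_all add: norm_mult ne LIM_zero_iff)
  have sq: "((\<lambda>x. (cmod (P x))\<^sup>2) \<longlongrightarrow> 4 * \<omega>\<^sup>2 * (cmod \<alpha>)\<^sup>2) F"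
    "((\<lambda>x. (cmod (N x))\<^sup>2) \<longlongrightarrow> 4 * \<omega>\<^sup>2 * (cmod \<beta>)\<^sup>2) F"
    using tendsto_power[OF nP, of 2] tendsto_power[OF nN, of 2] by (simp_all add: power_mult_distrib)
  have s1: "(cmod (\<psi>' x))\<^sup>2 + \<omega>\<^sup>2 * (cmod (\<psi> x))\<^sup>2 = ((cmod (P x))\<^sup>2 + (cmod (N x))\<^sup>2) / 2" for x
    unfolding cmod_power2 P_def N_def by (simp add: power2_eq_square algebra_simps)
  have s2: "Im (cnj (\<psi> x) * \<psi>' x) = ((cmod (P x))\<^sup>2 - (cmod (N x))\<^sup>2) / (4 * \<omega>)" for x
    unfolding cmod_power2 P_def N_def using \<omega> by (simp add: power2_eq_square field_simps)
  show "((\<lambda>x. Im (cnj (\<psi> x) * \<psi>' x)) \<longlongrightarrow> \<omega> * ((cmod \<alpha>)\<^sup>2 - (cmod \<beta>)\<^sup>2)) F"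
  proof -
    have "4 * \<omega>\<^sup>2 * (cmod \<alpha>)\<^sup>2 - 4 * \<omega>\<^sup>2 * (cmod \<beta>)\<^sup>2 = \<omega> * ((cmod \<alpha>)\<^sup>2 - (cmod \<beta>)\<^sup>2) * (4 * \<omega>)"
      by (simp add: power2_eq_square algebra_simps)
    then show ?thesis
      unfolding s2 using tendsto_divide[OF tendsto_diff[OF sq] tendsto_const[of "4 * \<omega>"]] \<omega> by simp
  qed
  \<comment> \<open>Boundedness of \<open>\<psi>\<close> makes \<open>V\<close> times its squared
    modulus negligible, so the energy may carry \<open>\<omega>^2 - V\<close> in place of
    \<open>\<omega>^2\<close>.\<close>
  have b\<psi>: "Bfun \<psi> F"
  proof -
    have "Bfun (\<lambda>x. f x + (\<alpha> * e x + \<beta> * e1 x)) F"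
    proof -
      obtain K where K: "eventually (\<lambda>x. norm (\<alpha> * e x + \<beta> * e1 x) \<le> K) F"
        using bu by (auto elim: BfunE)
      have "eventually (\<lambda>x. norm (f x) < 1) F"
        using tendstoD[OF lim_f, of 1] by simp
      with K have "eventually (\<lambda>x. norm (f x + (\<alpha> * e x + \<beta> * e1 x)) \<le> K + 1) F"
      proof eventually_elim
        case (elim x)
        then show ?case using norm_triangle_ineq[of "f x" "\<alpha> * e x + \<beta> * e1 x"] by linarith
      qed
      then show ?thesis by (rule BfunI)
    qed
    then show ?thesis by (simp add: f_def)
  qed
  have "((\<lambda>x. of_real (V x) * \<psi> x * \<psi> x) \<longlongrightarrow> 0) F"
    using bounded_bilinear.Zfun_prod_Bfun[OF bounded_bilinear_mult _ b\<psi>] V\<psi>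
    by (simp add: tendsto_Zfun_iff)
  then have "((\<lambda>x. \<bar>V x * (cmod (\<psi> x))\<^sup>2\<bar>) \<longlongrightarrow> 0) F"
    by (drule_tac tendsto_norm_zero) (simp add: norm_mult power2_eq_square abs_mult mult.assoc)
  then have V2: "((\<lambda>x. V x * (cmod (\<psi> x))\<^sup>2) \<longlongrightarrow> 0) F"
    by (rule tendsto_rabs_zero_cancel)
  have "((\<lambda>x. ((cmod (P x))\<^sup>2 + (cmod (N x))\<^sup>2) / 2 - V x * (cmod (\<psi> x))\<^sup>2) \<longlongrightarrow>
      (4 * \<omega>\<^sup>2 * (cmod \<alpha>)\<^sup>2 + 4 * \<omega>\<^sup>2 * (cmod \<beta>)\<^sup>2) / 2 - 0) F"
    by (intro tendsto_intros sq V2) simp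
  then show "((\<lambda>x. (cmod (\<psi>' x))\<^sup>2 + (\<omega>\<^sup>2 - V x) * (cmod (\<psi> x))\<^sup>2) \<longlongrightarrow> 2 * \<omega>\<^sup>2 * ((cmod \<alpha>)\<^sup>2 + (cmod \<beta>)\<^sup>2)) F"
    unfolding s1[symmetric] by (simp add: algebra_simps add_divide_distrib)
qed

section \<open>Shape of the Regge-Wheeler potential\<close>

text \<open>In \<open>u = 2 * m / r\<close> the derivative is a quadratic \<open>q\<close> up to the
  factor \<open>- 1 / r ^ 3\<close>. The peak supplies a root \<open>u0\<close> in (0,1). The signs
  \<open>q 0 \<ge> 0\<close> and \<open>q 1 < 0\<close> force the remaining affine factor to be
  nonpositive on (0,1), so the slope changes sign only at the peak.\<close>

lemma unimodal_RW_potential: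
  assumes "m > 0" "s \<le> l"
  obtains r0 V' where "r0 > 2 * m" "RW_potential m s l r0 = V_peak m s l"
    "\<And>r. r > 2 * m \<Longrightarrow> (RW_potential m s l has_real_derivative V' r) (at r)"
    "\<And>r. 2 * m < r \<Longrightarrow> r \<le> r0 \<Longrightarrow> V' r \<ge> 0"
    "\<And>r. r0 \<le> r \<Longrightarrow> V' r \<le> 0"
proof -
  obtain r0 where r0: "r0 > 2 * m" "RW_potential m s l r0 = V_peak m s l"
    using V_peak_attained(1)[OF assms] by blast
  define L where "L = real l * (real l + 1)"
  define \<sigma> where "\<sigma> = 1 - (real s)\<^sup>2"
  define q where "q u = 2 * L + 3 * (\<sigma> - L) * u - 4 * \<sigma> * u\<^sup>2" for u
  define V' where "V' r = - q (2 * m / r) / r ^ 3" for r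
  have der: "(RW_potential m s l has_real_derivative V' r) (at r)" if "r > 2 * m" for r
  proof -
    have "r > 0" using that assms by simp
    then show ?thesis
      unfolding RW_potential_def[abs_def] L_def[symmetric] \<sigma>_def[symmetric] V'_def q_def
      by (auto intro!: derivative_eq_intros simp: field_simps power2_eq_square eval_nat_numeral)
  qed
  have "V' r0 = 0"
  \<comment> \<open>The radius \<open>r0 - 2 * m\<close> keeps the neighbourhood outside the
    horizon, where the peak dominates.\<close>
  proof (rule DERIV_local_max[OF der[OF r0(1)], of "r0 - 2 * m"])
    show "\<forall>y. \<bar>r0 - y\<bar> < r0 - 2 * m \<longrightarrow> RW_potential m s l y \<le> RW_potential m s l r0"
      using V_peak_attained(2)[OF assms] r0(2) by auto
  qed (use r0 in auto)
  define u0 where "u0 = 2 * m / r0"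
  have u0: "0 < u0" "u0 < 1"
    using assms r0 by (auto simp: u0_def)
  have q0: "q u0 = 0"
    using \<open>V' r0 = 0\<close> r0 assms by (auto simp: V'_def u0_def)
  have L0: "L \<ge> 0" by (simp add: L_def)
  have "real s * (real s + 1) \<le> L"
    unfolding L_def using assms by (intro mult_mono) auto
  \<comment> \<open>This is \<open>- q 1\<close>; it is at least \<open>s + 1\<close> because
    \<open>s \<le> l\<close>.\<close>
  then have "L + \<sigma> > 0"
    by (simp add: \<sigma>_def power2_eq_square distrib_left)
  \<comment> \<open>The cofactor of the root: \<open>q u - q u0\<close> divided by
    \<open>u - u0\<close>.\<close>
  define g where "g u = 3 * (\<sigma> - L) - 4 * \<sigma> * (u + u0)" for u
  have qg: "q u = (u - u0) * g u" for u
    using q0 by (simp add: q_def g_def power2_eq_square algebra_simps)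
  have "g 0 * u0 \<le> 0" using qg[of 0] L0 by (simp add: q_def mult.commute)
  then have g0: "g 0 \<le> 0" using u0 by (simp add: mult_le_0_iff)
  have "(1 - u0) * g 1 < 0" using qg[of 1] \<open>L + \<sigma> > 0\<close> by (simp add: q_def)
  then have g1: "g 1 \<le> 0" using u0 by (simp add: mult_less_0_iff)
  have g: "g u \<le> 0" if "0 < u" "u < 1" for u
  proof -
    \<comment> \<open>Being affine, \<open>g\<close> is on (0,1) a convex combination of its end
      values.\<close>
    have "g u = (1 - u) * g 0 + u * g 1" by (simp add: g_def algebra_simps)
    moreover have "(1 - u) * g 0 \<le> 0" "u * g 1 \<le> 0"
      using that g0 g1 by (auto simp: mult_nonneg_nonpos)
    ultimately show ?thesis by linarith
  qed
  have gr: "g (2 * m / r) \<le> 0" if "2 * m < r" for r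
    using that assms by (intro g) auto
  show ?thesis
  proof (rule that[OF r0 der])
    fix r assume r: "2 * m < r" "r \<le> r0"
    \<comment> \<open>The substitution reverses the order: left of the peak in \<open>r\<close> is
      right of \<open>u0\<close> in \<open>u\<close>.\<close>
    then have "u0 \<le> 2 * m / r"
      unfolding u0_def using assms by (intro divide_left_mono) auto
    then have "(2 * m / r - u0) * g (2 * m / r) \<le> 0"
      using r gr[of r] by (intro mult_nonneg_nonpos) auto
    then show "V' r \<ge> 0"
      using r assms by (simp add: V'_def qg divide_le_0_iff)
  next
    fix r assume r: "r0 \<le> r"
    then have "2 * m / r \<le> u0"
      unfolding u0_def using assms r0 by (intro divide_left_mono) auto
    then have "(2 * m / r - u0) * g (2 * m / r) \<ge> 0"
      using r r0 gr[of r] by (intro mult_nonpos_nonpos) auto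
    then show "V' r \<le> 0"
      using r r0 assms by (simp add: V'_def qg zero_le_divide_iff)
  qed
qed

section \<open>The transmission bound for a single-hump potential\<close>

text \<open>Separates the scattering argument from the black hole: of the potential it uses only the
  decay at both ends, the rise up to \<open>p\<close>, the fall afterwards, and a peak below
  \<open>\<omega>^2\<close>.\<close>

lemma transmission_bound_unimodal:
  fixes \<psi> \<psi>' \<psi>'' :: "real \<Rightarrow> complex" and V V' :: "real \<Rightarrow> real"
  assumes \<omega>: "\<omega> > 0"
    and d: "\<And>x. (\<psi> has_vector_derivative \<psi>' x) (at x)"
    and d': "\<And>x. (\<psi>' has_vector_derivative \<psi>'' x) (at x)"
    and ode: "\<And>x. \<psi>'' x + of_real (\<omega>\<^sup>2 - V x) * \<psi> x = 0"
    and V: "(V \<longlongrightarrow> 0) at_bot" "(V \<longlongrightarrow> 0) at_top"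
    and dV: "\<And>x. (V has_real_derivative V' x) (at x)"
    and up: "\<And>x. x \<le> p \<Longrightarrow> V' x \<ge> 0"
    and down: "\<And>x. x \<ge> p \<Longrightarrow> V' x \<le> 0"
    and Vp: "V p < \<omega>\<^sup>2"
    and bot: "((\<lambda>x. \<psi> x - exp (\<i> * of_real (\<omega> * x))) \<longlongrightarrow> 0) at_bot"
    and top: "((\<lambda>x. \<psi> x - (\<alpha> * exp (\<i> * of_real (\<omega> * x)) + \<beta> * exp (- \<i> * of_real (\<omega> * x)))) \<longlongrightarrow> 0) at_top"
  shows "4 * \<omega>\<^sup>2 * (\<omega>\<^sup>2 - V p) / (2 * \<omega>\<^sup>2 - V p)\<^sup>2 \<le> 1 / (cmod \<alpha>)\<^sup>2"
proof -
  define a where "a x = (cmod (\<psi> x))\<^sup>2" for x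
  define b where "b x = (cmod (\<psi>' x))\<^sup>2" for x
  define Q where "Q x = \<omega>\<^sup>2 - V x" for x
  define E where "E x = b x + Q x * a x" for x
  define J where "J x = Im (cnj (\<psi> x) * \<psi>' x)" for x

  have V_up: "V x \<le> V y" if "x \<le> y" "y \<le> p" for x y
    using that by (intro DERIV_nonneg_imp_nondecreasing[OF that(1)]) (meson dV up order_trans)
  have V_down: "V y \<le> V x" if "p \<le> x" "x \<le> y" for x y
    using that by (intro DERIV_nonpos_imp_nonincreasing[OF that(2)]) (meson dV down order_trans)
  have V_le: "V x \<le> V p" for x
    using V_up[of x p] V_down[of p x] by linarith
  then have Q0: "Q x > 0" for x
    using le_less_trans[OF V_le Vp, of x] by (simp add: Q_def)
  have ode': "\<psi>'' x = - of_real (Q x) * \<psi> x" for x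
    using ode[of x] by (simp only: Q_def eq_neg_iff_add_eq_0 mult_minus_left)
  note Re_Im = has_field_derivative_Re[OF d] has_field_derivative_Im[OF d]
    has_field_derivative_Re[OF d'] has_field_derivative_Im[OF d']
  have dQ: "(Q has_real_derivative - V' x) (at x)" for x
    unfolding Q_def by (auto intro!: derivative_eq_intros dV)
  \<comment> \<open>The terms with \<open>\<psi>''\<close> cancel by the equation, so
    \<open>E\<close> changes only through \<open>Q\<close>.\<close>
  have dE: "(E has_real_derivative - V' x * a x) (at x)" for x
    unfolding E_def a_def b_def cmod_power2
    by (rule derivative_eq_intros Re_Im dQ refl)+ (simp add: ode' algebra_simps)
  have J_eq: "J = (\<lambda>x. Re (\<psi> x) * Im (\<psi>' x) - Im (\<psi> x) * Re (\<psi>' x))"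
    by (simp add: J_def fun_eq_iff)
  have "(J has_real_derivative 0) (at x)" for x
    unfolding J_eq
    by (rule derivative_eq_intros Re_Im dQ refl)+ (simp add: ode' algebra_simps)
  then have "J x = J 0" for x
    by (intro DERIV_isconst_all allI)
  then obtain C where J_const: "\<And>x. J x = C" by blast

  \<comment> \<open>The pure wave at minus infinity is the two-wave form with coefficients 1 and
    0.\<close>
  have bot': "((\<lambda>x. \<psi> x - (1 * exp (\<i> * of_real (\<omega> * x)) + 0 * exp (- \<i> * of_real (\<omega> * x)))) \<longlongrightarrow> 0) at_bot"
    using bot by simp
  note as_bot = scattering_asymptotics[OF disjI1[OF refl] \<omega> d d' ode V(1) bot', folded a_def b_def Q_def, folded E_def J_def]
  note as_top = scattering_asymptotics[OF disjI2[OF refl] \<omega> d d' ode V(2) top, folded a_def b_def Q_def, folded E_def J_def]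
  have J\<omega>: "J x = \<omega>" for x
    using as_bot(2) by (simp add: J_const tendsto_const_iff)
  have "((\<lambda>y::real. \<omega>) \<longlongrightarrow> \<omega> * ((cmod \<alpha>)\<^sup>2 - (cmod \<beta>)\<^sup>2)) at_top"
    using as_top(2) by (simp add: J\<omega>)
  then have "\<omega> = \<omega> * ((cmod \<alpha>)\<^sup>2 - (cmod \<beta>)\<^sup>2)"
    by (simp add: tendsto_const_iff)
  \<comment> \<open>Equating the flux at both ends gives this unitarity relation.\<close>
  then have \<beta>: "(cmod \<beta>)\<^sup>2 = (cmod \<alpha>)\<^sup>2 - 1"
    using \<omega> by simp
  define A where "A = (cmod \<alpha>)\<^sup>2"
  define c where "c = 2 * \<omega>\<^sup>2 * (2 * A - 1)"
  have A1: "A \<ge> 1"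
    using \<beta> zero_le_power2[of "cmod \<beta>"] by (simp add: A_def)
  have E_bot: "(E \<longlongrightarrow> 2 * \<omega>\<^sup>2) at_bot" and E_top: "(E \<longlongrightarrow> c) at_top"
    using as_bot(1) as_top(1) by (simp_all add: \<beta> c_def A_def)
  have Q_bot: "(Q \<longlongrightarrow> \<omega>\<^sup>2) at_bot" and Q_top: "(Q \<longlongrightarrow> \<omega>\<^sup>2) at_top"
    using tendsto_diff[OF tendsto_const V(1), of "\<omega>\<^sup>2"] tendsto_diff[OF tendsto_const V(2), of "\<omega>\<^sup>2"]
    by (simp_all add: Q_def[abs_def])

  \<comment> \<open>The flux is at most the product of the moduli of \<open>\<psi>\<close> and
    \<open>\<psi>'\<close>.\<close>
  have ab: "a x * b x \<ge> \<omega>\<^sup>2" for x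
  proof -
    have "\<omega> \<le> cmod (cnj (\<psi> x) * \<psi>' x)"
      using abs_Im_le_cmod[of "cnj (\<psi> x) * \<psi>' x"] J\<omega>[of x] by (simp add: J_def)
    then have "\<omega>\<^sup>2 \<le> (cmod (cnj (\<psi> x) * \<psi>' x))\<^sup>2"
      using \<omega> by (intro power_mono) auto
    then show ?thesis by (simp add: a_def b_def norm_mult power_mult_distrib)
  qed
  have a0: "a x \<ge> 0" and b0: "b x \<ge> 0" for x
    by (simp_all add: a_def b_def)

  text \<open>Replacing the flux \<open>\<omega>\<close> by a smaller \<open>w\<close> keeps the radicand below positive,
    so that the square root is differentiable.\<close>
  have key: "4 * w\<^sup>2 * Q p \<le> (c - sqrt (c\<^sup>2 - 4 * w\<^sup>2 * \<omega>\<^sup>2)) * (2 * \<omega>\<^sup>2 + sqrt ((2 * \<omega>\<^sup>2)\<^sup>2 - 4 * w\<^sup>2 * \<omega>\<^sup>2))"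
    if w: "0 < w" "w < \<omega>" for w
  proof -
    \<comment> \<open>For constant \<open>Q\<close> and \<open>w = \<omega>\<close> the curve
      \<open>\<psi>\<close> is an ellipse, and \<open>(E + S) / 2\<close>,
      \<open>(E - S) / 2\<close> are \<open>Q\<close> times its squared semi-axes. The inequalities
      \<open>f1\<close> and \<open>f2\<close> below reflect that \<open>a\<close> lies between these
      squares.\<close>
    define S where "S x = sqrt ((E x)\<^sup>2 - 4 * w\<^sup>2 * Q x)" for x
    have w\<omega>: "w\<^sup>2 < \<omega>\<^sup>2"
      using w by (simp add: power_strict_mono)
    \<comment> \<open>Written as a square plus a positive multiple of the gap
      \<open>a x * b x - w\<^sup>2\<close>, the radicand is visibly positive.\<close>
    have rad: "(E x)\<^sup>2 - 4 * w\<^sup>2 * Q x = (b x - Q x * a x)\<^sup>2 + 4 * Q x * (a x * b x - w\<^sup>2)" for x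
      by (simp add: E_def power2_eq_square algebra_simps)
    have gap: "a x * b x - w\<^sup>2 > 0" for x
      using ab[of x] w\<omega> by linarith
    have rad_pos: "(E x)\<^sup>2 - 4 * w\<^sup>2 * Q x > 0" for x
      unfolding rad using gap[of x] Q0[of x] by (intro add_nonneg_pos) auto
    have S0: "S x > 0" for x
      using rad_pos by (simp add: S_def)
    have S_ge: "\<bar>b x - Q x * a x\<bar> \<le> S x" for x
    proof -
      have "(b x - Q x * a x)\<^sup>2 \<le> (E x)\<^sup>2 - 4 * w\<^sup>2 * Q x"
        unfolding rad using gap[of x] Q0[of x] by simp
      then show ?thesis
        unfolding S_def using real_sqrt_le_mono by fastforce
    qed
    have prod: "(E x + S x) * (E x - S x) = 4 * w\<^sup>2 * Q x" for x
    proof -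
      have "(S x)\<^sup>2 = (E x)\<^sup>2 - 4 * w\<^sup>2 * Q x"
        using rad_pos[of x] by (simp add: S_def)
      then show ?thesis by (simp add: power2_eq_square algebra_simps)
    qed
    have dS: "(S has_real_derivative - V' x * (E x * a x - 2 * w\<^sup>2) / S x) (at x)" for x
      unfolding S_def using rad_pos[of x]
      by (auto intro!: derivative_eq_intros dE dQ simp: field_simps)
    have dplus: "((\<lambda>x. E x + S x) has_real_derivative - V' x * ((E x + S x) * a x - 2 * w\<^sup>2) / S x) (at x)" for x
      by (rule derivative_eq_intros dE dS refl)+ (use S0[of x] in \<open>simp add: field_simps\<close>)
    have dminus: "((\<lambda>x. E x - S x) has_real_derivative - V' x * (2 * w\<^sup>2 - (E x - S x) * a x) / S x) (at x)" for x
      by (rule derivative_eq_intros dE dS refl)+ (use S0[of x] in \<open>simp add: field_simps\<close>)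
    \<comment> \<open>The sum and the absolute difference of \<open>b x\<close> and
      \<open>Q x * a x\<close> add up to twice their maximum.\<close>
    have plus_ge: "2 * b x \<le> E x + S x" "2 * (Q x * a x) \<le> E x + S x" for x
      using S_ge[of x] by (auto simp: E_def)
    have f1: "(E x + S x) * a x - 2 * w\<^sup>2 \<ge> 0" for x
      using mult_right_mono[OF plus_ge(1) a0, of x x] gap[of x] by (simp add: mult.commute)
    have ES: "E x + S x > 0" for x
      using Q0[of x] a0[of x] b0[of x] S0[of x] by (simp add: E_def add_nonneg_pos)
    have f2: "2 * w\<^sup>2 - (E x - S x) * a x \<ge> 0" for x
    proof -
      have m0: "E x - S x \<ge> 0"
        using mult_nonneg_nonneg[of "4 * w\<^sup>2" "Q x", folded prod] Q0[of x] ES[of x] by (simp add: zero_le_mult_iff)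
      \<comment> \<open>Multiplying by \<open>Q x\<close> brings in the product of both quantities,
        which is known exactly.\<close>
      have "Q x * ((E x - S x) * a x) * 2 \<le> (E x + S x) * (E x - S x)"
        using mult_right_mono[OF plus_ge(2) m0, of x] by (simp add: algebra_simps)
      also have "\<dots> = Q x * (2 * w\<^sup>2) * 2"
        by (simp add: prod)
      finally show ?thesis using Q0[of x] by (simp add: mult.commute)
    qed
    have S_lim: "(S \<longlongrightarrow> sqrt ((2 * \<omega>\<^sup>2)\<^sup>2 - 4 * w\<^sup>2 * \<omega>\<^sup>2)) at_bot" "(S \<longlongrightarrow> sqrt (c\<^sup>2 - 4 * w\<^sup>2 * \<omega>\<^sup>2)) at_top"
      unfolding S_def by (intro tendsto_intros E_bot Q_bot E_top Q_top)+
    have left: "E p + S p \<le> 2 * \<omega>\<^sup>2 + sqrt ((2 * \<omega>\<^sup>2)\<^sup>2 - 4 * w\<^sup>2 * \<omega>\<^sup>2)"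
    proof (rule tendsto_lowerbound[OF tendsto_add[OF E_bot S_lim(1)]])
      have "E p + S p \<le> E x + S x" if "x \<le> p" for x
      proof (rule DERIV_nonpos_imp_nonincreasing[OF that])
        fix y assume "x \<le> y" "y \<le> p"
        then have "- V' y * ((E y + S y) * a y - 2 * w\<^sup>2) / S y \<le> 0"
          using up[of y] f1[of y] S0[of y] by (simp add: divide_nonneg_pos)
        then show "\<exists>z. ((\<lambda>x. E x + S x) has_real_derivative z) (at y) \<and> z \<le> 0"
          using dplus by blast
      qed
      then show "eventually (\<lambda>x. E p + S p \<le> E x + S x) at_bot"
        unfolding eventually_at_bot_linorder by blast
    qed simp
    have right: "E p - S p \<le> c - sqrt (c\<^sup>2 - 4 * w\<^sup>2 * \<omega>\<^sup>2)"
    proof (rule tendsto_lowerbound[OF tendsto_diff[OF E_top S_lim(2)]])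
      have "E p - S p \<le> E x - S x" if "p \<le> x" for x
      proof (rule DERIV_nonneg_imp_nondecreasing[OF that])
        fix y assume "p \<le> y" "y \<le> x"
        then have "- V' y * (2 * w\<^sup>2 - (E y - S y) * a y) / S y \<ge> 0"
          using down[of y] f2[of y] S0[of y] by (intro divide_nonneg_pos mult_nonneg_nonneg) auto
        then show "\<exists>z. ((\<lambda>x. E x - S x) has_real_derivative z) (at y) \<and> 0 \<le> z"
          using dminus by blast
      qed
      then show "eventually (\<lambda>x. E p - S p \<le> E x - S x) at_top"
        unfolding eventually_at_top_linorder by blast
    qed simp
    \<comment> \<open>Both factors at \<open>p\<close> are positive, so the bounds
      \<open>left\<close> and \<open>right\<close> may be multiplied.\<close>
    have "0 < (E p + S p) * (E p - S p)"
      unfolding prod using w Q0[of p] by simp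
    then have "E p - S p > 0"
      using ES[of p] by (simp add: zero_less_mult_iff)
    then have "(E p - S p) * (E p + S p) \<le> (c - sqrt (c\<^sup>2 - 4 * w\<^sup>2 * \<omega>\<^sup>2)) * (2 * \<omega>\<^sup>2 + sqrt ((2 * \<omega>\<^sup>2)\<^sup>2 - 4 * w\<^sup>2 * \<omega>\<^sup>2))"
      using left right ES[of p] by (intro mult_mono) auto
    then show ?thesis
      by (simp only: prod mult.commute[of "E p - S p"])
  qed
  \<comment> \<open>Both sides are continuous in \<open>w\<close>, so the inequality survives the
    limit from the left.\<close>
  have "4 * \<omega>\<^sup>2 * Q p \<le> (c - sqrt (c\<^sup>2 - 4 * \<omega>\<^sup>2 * \<omega>\<^sup>2)) * (2 * \<omega>\<^sup>2 + sqrt ((2 * \<omega>\<^sup>2)\<^sup>2 - 4 * \<omega>\<^sup>2 * \<omega>\<^sup>2))"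
  proof (rule tendsto_le)
    show "((\<lambda>w. 4 * w\<^sup>2 * Q p) \<longlongrightarrow> 4 * \<omega>\<^sup>2 * Q p) (at_left \<omega>)"
      by (intro tendsto_intros)
    show "((\<lambda>w. (c - sqrt (c\<^sup>2 - 4 * w\<^sup>2 * \<omega>\<^sup>2)) * (2 * \<omega>\<^sup>2 + sqrt ((2 * \<omega>\<^sup>2)\<^sup>2 - 4 * w\<^sup>2 * \<omega>\<^sup>2)))
      \<longlongrightarrow> (c - sqrt (c\<^sup>2 - 4 * \<omega>\<^sup>2 * \<omega>\<^sup>2)) * (2 * \<omega>\<^sup>2 + sqrt ((2 * \<omega>\<^sup>2)\<^sup>2 - 4 * \<omega>\<^sup>2 * \<omega>\<^sup>2))) (at_left \<omega>)"
      by (intro tendsto_intros)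
    show "eventually (\<lambda>w. 4 * w\<^sup>2 * Q p \<le> (c - sqrt (c\<^sup>2 - 4 * w\<^sup>2 * \<omega>\<^sup>2)) * (2 * \<omega>\<^sup>2 + sqrt ((2 * \<omega>\<^sup>2)\<^sup>2 - 4 * w\<^sup>2 * \<omega>\<^sup>2))) (at_left \<omega>)"
      using eventually_at_left_real[OF \<omega>] by eventually_elim (use key in auto)
  qed simp
  \<comment> \<open>The pure wave traces a circle: its semi-axes agree, and the radicand at minus
    infinity vanishes.\<close>
  also have "(2 * \<omega>\<^sup>2)\<^sup>2 - 4 * \<omega>\<^sup>2 * \<omega>\<^sup>2 = 0"
    by (simp add: power2_eq_square)
  finally have "\<omega>\<^sup>2 * (2 * Q p) \<le> \<omega>\<^sup>2 * (c - sqrt (c\<^sup>2 - 4 * \<omega>\<^sup>2 * \<omega>\<^sup>2))"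
    by (simp add: algebra_simps)
  then have sq: "sqrt (c\<^sup>2 - 4 * \<omega>\<^sup>2 * \<omega>\<^sup>2) \<le> c - 2 * Q p"
    using \<omega> by simp
  have "c \<ge> 2 * \<omega>\<^sup>2 * 1"
    unfolding c_def using A1 by (intro mult_left_mono) auto
  then have "c\<^sup>2 \<ge> (2 * \<omega>\<^sup>2)\<^sup>2"
    by (intro power_mono) auto
  then have rad0: "c\<^sup>2 - 4 * \<omega>\<^sup>2 * \<omega>\<^sup>2 \<ge> 0"
    by (simp add: power2_eq_square)
  have "c\<^sup>2 - 4 * \<omega>\<^sup>2 * \<omega>\<^sup>2 \<le> (c - 2 * Q p)\<^sup>2"
    using power_mono[OF sq, of 2] rad0 by simp
  then have "c * Q p \<le> \<omega>\<^sup>2 * \<omega>\<^sup>2 + (Q p)\<^sup>2"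
    by (simp add: power2_eq_square algebra_simps)
  \<comment> \<open>Inserting \<open>c\<close> completes the square on the right;
    \<open>\<omega>^2 + Q p\<close> is the \<open>2 * \<omega>^2 - V p\<close> of the claim.\<close>
  then have fin: "4 * \<omega>\<^sup>2 * Q p * A \<le> (\<omega>\<^sup>2 + Q p)\<^sup>2"
    by (simp add: c_def power2_eq_square algebra_simps)
  have "\<omega>\<^sup>2 + Q p > 0"
    using Q0[of p] by (simp add: add_nonneg_pos)
  then have "4 * \<omega>\<^sup>2 * Q p / (\<omega>\<^sup>2 + Q p)\<^sup>2 \<le> 1 / A"
    using fin A1 by (simp add: divide_simps)
  then show ?thesis
    by (simp add: Q_def A_def algebra_simps)
qed

section \<open>The tortoise coordinate and its inverse\<close>

lemma has_derivative_tortoise: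
  assumes "m > 0" "r > 2 * m"
  shows "(tortoise m has_real_derivative 1 / (1 - 2 * m / r)) (at r)"
  unfolding tortoise_def[abs_def] using assms
  by (auto intro!: derivative_eq_intros simp: field_simps)

lemma radius_tortoise:
  assumes "m > 0" "r > 2 * m"
  shows "radius m (tortoise m r) = r"
  unfolding radius_def using tortoise_bij[OF assms(1)] assms(2)
  by (intro inv_into_f_f) (auto simp: bij_betw_def)

lemma radius_gt:
  assumes "m > 0"
  shows "radius m x > 2 * m"
  using bij_betwE[OF bij_betw_inv_into[OF tortoise_bij[OF assms]]] by (auto simp: radius_def)

lemma tortoise_radius:
  assumes "m > 0"
  shows "tortoise m (radius m x) = x"
  using bij_betw_inv_into_right[OF tortoise_bij[OF assms]] by (simp add: radius_def)

lemma tortoise_strict_mono: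
  assumes "m > 0" "2 * m < r" "r < r'"
  shows "tortoise m r < tortoise m r'"
proof (rule DERIV_pos_imp_increasing[OF assms(3)])
  fix y assume "r \<le> y" "y \<le> r'"
  then show "\<exists>z. (tortoise m has_real_derivative z) (at y) \<and> 0 < z"
    using assms by (intro exI[of _ "1 / (1 - 2 * m / y)"] conjI has_derivative_tortoise) auto
qed

text \<open>These equivalences carry the limits of \<open>radius\<close> and the two sides of the
  peak over to the tortoise line.\<close>

lemma
  assumes "m > 0" "r > 2 * m"
  shows radius_le_iff: "radius m x \<le> r \<longleftrightarrow> x \<le> tortoise m r"
    and le_radius_iff: "r \<le> radius m x \<longleftrightarrow> tortoise m r \<le> x"
  using tortoise_strict_mono[OF assms(1) radius_gt[OF assms(1)], of x r]
    tortoise_strict_mono[OF assms, of "radius m x"] tortoise_radius[OF assms(1), of x]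
  by (cases r "radius m x" rule: linorder_cases; force)+

lemma has_derivative_radius:
  assumes "m > 0"
  shows "(radius m has_real_derivative 1 - 2 * m / radius m x) (at x)"
proof -
  let ?r = "radius m x"
  have r: "?r > 2 * m" using assms by (rule radius_gt)
  have "isCont (radius m) (tortoise m ?r)"
  \<comment> \<open>Half the distance to the horizon keeps the neighbourhood in the exterior
    region.\<close>
  proof (rule isCont_inverse_function[of "(?r - 2 * m) / 2" ?r "radius m" "tortoise m"])
    fix z assume "\<bar>z - ?r\<bar> \<le> (?r - 2 * m) / 2"
    then have "?r - z \<le> (?r - 2 * m) / 2"
      by (simp only: abs_le_iff minus_diff_eq)
    then have z: "z > 2 * m" using r by (simp add: field_simps)
    then show "radius m (tortoise m z) = z"
      by (rule radius_tortoise[OF assms])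
    show "isCont (tortoise m) z"
      using has_derivative_tortoise[OF assms z] by (rule DERIV_isCont)
  qed (use r in simp)
  then have cont: "isCont (radius m) x"
    by (simp add: tortoise_radius[OF assms])
  have "(radius m has_real_derivative inverse (1 / (1 - 2 * m / ?r))) (at x)"
    by (rule DERIV_inverse_function[where f = "tortoise m" and a = "x - 1" and b = "x + 1"])
      (use r assms cont has_derivative_tortoise[OF assms r] in \<open>auto simp: tortoise_radius\<close>)
  then show ?thesis by simp
qed

lemma filterlim_radius_at_top:
  assumes "m > 0"
  shows "filterlim (radius m) at_top at_top"
  unfolding filterlim_at_top_gt[where c = "2 * m"]
proof (intro allI impI)
  fix Z assume Z: "2 * m < Z"
  have "Z \<le> radius m x" if "x \<ge> tortoise m Z" for x
    using le_radius_iff[OF assms Z] that by simp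
  then show "eventually (\<lambda>x. Z \<le> radius m x) at_top"
    unfolding eventually_at_top_linorder by blast
qed

lemma tendsto_radius_at_bot:
  assumes "m > 0"
  shows "(radius m \<longlongrightarrow> 2 * m) at_bot"
proof (rule order_tendstoI)
  fix z assume "z < 2 * m"
  then show "eventually (\<lambda>x. z < radius m x) at_bot"
    using radius_gt[OF assms] by (intro always_eventually allI) (meson order_less_trans)
next
  fix z assume "2 * m < z"
  \<comment> \<open>The intermediate \<open>y\<close> turns the non-strict equivalence into a strict
    bound by \<open>z\<close>.\<close>
  then obtain y where y: "2 * m < y" "y < z" using dense by blast
  then have "radius m x < z" if "x \<le> tortoise m y" for x
    using radius_le_iff[OF assms y(1), of x] that by linarith
  then show "eventually (\<lambda>x. radius m x < z) at_bot"
    unfolding eventually_at_bot_linorder by blast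
qed

lemma tendsto_RW_potential_radius:
  assumes "m > 0"
  shows "((\<lambda>x. RW_potential m s l (radius m x)) \<longlongrightarrow> 0) at_bot"
    and "((\<lambda>x. RW_potential m s l (radius m x)) \<longlongrightarrow> 0) at_top"
proof -
  \<comment> \<open>The formula is continuous at the horizon itself, where the factor
    \<open>1 - 2 * m / r\<close> vanishes.\<close>
  have "((\<lambda>x. RW_potential m s l (radius m x)) \<longlongrightarrow> RW_potential m s l (2 * m)) at_bot"
    unfolding RW_potential_def using assms
    by (intro tendsto_intros tendsto_radius_at_bot) auto
  then show "((\<lambda>x. RW_potential m s l (radius m x)) \<longlongrightarrow> 0) at_bot"
    using assms by (simp add: RW_potential_def)
  have "(RW_potential m s l \<longlongrightarrow> (1 - 2 * m * 0) * (real l * (real l + 1) * 0\<^sup>2 + 2 * m * (1 - (real s)\<^sup>2) * 0 ^ 3)) at_top"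
    unfolding RW_potential_def[abs_def] divide_inverse power_inverse[symmetric]
    by (intro tendsto_intros tendsto_inverse_0_at_top filterlim_ident)
  then have "(RW_potential m s l \<longlongrightarrow> 0) at_top" by simp
  then show "((\<lambda>x. RW_potential m s l (radius m x)) \<longlongrightarrow> 0) at_top"
    by (rule filterlim_compose[OF _ filterlim_radius_at_top[OF assms]])
qed

section \<open>Application to the greybody factor\<close>

theorem mainTheorem5:
  fixes m \<omega> T :: real and s l :: nat
  assumes "m > 0" and "\<omega> > 0" and "l \<ge> s"
    and "is_greybody_factor m s l \<omega> T"
    and "\<omega>\<^sup>2 > V_peak m s l"
  shows "T \<ge> 4 * \<omega>\<^sup>2 * (\<omega>\<^sup>2 - V_peak m s l) / (2 * \<omega>\<^sup>2 - V_peak m s l)\<^sup>2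
       \<and> 4 * \<omega>\<^sup>2 * (\<omega>\<^sup>2 - V_peak m s l) / (2 * \<omega>\<^sup>2 - V_peak m s l)\<^sup>2
         = 1 - (V_peak m s l)\<^sup>2 / (2 * \<omega>\<^sup>2 - V_peak m s l)\<^sup>2"
proof
  obtain r0 V' where r0: "r0 > 2 * m" "RW_potential m s l r0 = V_peak m s l"
    and V': "\<And>r. r > 2 * m \<Longrightarrow> (RW_potential m s l has_real_derivative V' r) (at r)"
    and up: "\<And>r. 2 * m < r \<Longrightarrow> r \<le> r0 \<Longrightarrow> V' r \<ge> 0"
    and down: "\<And>r. r0 \<le> r \<Longrightarrow> V' r \<le> 0"
    using unimodal_RW_potential[OF assms(1,3)] by blast
  obtain \<psi> \<alpha> \<beta> where scat: "scattering_solution m s l \<omega> \<psi> \<alpha> \<beta>"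
    and T: "T = 1 / (cmod \<alpha>)\<^sup>2"
    using assms(4) unfolding is_greybody_factor_def by blast
  then have lims: "((\<lambda>x. \<psi> x - exp (\<i> * of_real (\<omega> * x))) \<longlongrightarrow> 0) at_bot"
      "((\<lambda>x. \<psi> x - (\<alpha> * exp (\<i> * of_real (\<omega> * x)) + \<beta> * exp (- \<i> * of_real (\<omega> * x)))) \<longlongrightarrow> 0) at_top"
    unfolding scattering_solution_def by blast+
  obtain \<psi>' \<psi>'' where
    sol: "\<And>x. (\<psi> has_vector_derivative \<psi>' x) (at x)"
      "\<And>x. (\<psi>' has_vector_derivative \<psi>'' x) (at x)"
      "\<And>x. \<psi>'' x + of_real (\<omega>\<^sup>2 - RW_potential m s l (radius m x)) * \<psi> x = 0"
    using scat unfolding scattering_solution_def RW_solution_def by blast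
  let ?p = "tortoise m r0"
  let ?V = "\<lambda>x. RW_potential m s l (radius m x)"
  \<comment> \<open>Chain rule: the factor is the derivative of \<open>radius\<close>, nonnegative
    outside the horizon, so the sign pattern of the slope carries over.\<close>
  let ?V' = "\<lambda>x. V' (radius m x) * (1 - 2 * m / radius m x)"
  have p: "?V ?p = V_peak m s l"
    using radius_tortoise[OF assms(1) r0(1)] r0(2) by simp
  have fac: "0 \<le> 1 - 2 * m / radius m x" for x
    using radius_gt[OF assms(1), of x] assms(1) by simp
  have dV: "(?V has_real_derivative ?V' x) (at x)" for x
    by (rule DERIV_chain2[OF V'[OF radius_gt[OF assms(1)]] has_derivative_radius[OF assms(1)]])
  have "4 * \<omega>\<^sup>2 * (\<omega>\<^sup>2 - ?V ?p) / (2 * \<omega>\<^sup>2 - ?V ?p)\<^sup>2 \<le> 1 / (cmod \<alpha>)\<^sup>2"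
  proof (rule transmission_bound_unimodal[OF assms(2) sol tendsto_RW_potential_radius[OF assms(1)] dV _ _ _ lims])
    show "0 \<le> ?V' x" if "x \<le> ?p" for x
      using up[OF radius_gt[OF assms(1)]] radius_le_iff[OF assms(1) r0(1)] that fac[of x] by simp
    show "?V' x \<le> 0" if "?p \<le> x" for x
    proof -
      have "r0 \<le> radius m x"
        using le_radius_iff[OF assms(1) r0(1)] that by simp
      then show ?thesis
        using down fac[of x] by (simp add: mult_nonpos_nonneg)
    qed
    show "?V ?p < \<omega>\<^sup>2" using p assms(5) by simp
  qed
  then show "T \<ge> 4 * \<omega>\<^sup>2 * (\<omega>\<^sup>2 - V_peak m s l) / (2 * \<omega>\<^sup>2 - V_peak m s l)\<^sup>2"
    by (simp only: p T)
  \<comment> \<open>With a nonzero denominator the identity is the difference of the squares of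
    \<open>2 * \<omega>^2 - V_peak m s l\<close> and \<open>V_peak m s l\<close>.\<close>
  have "2 * \<omega>\<^sup>2 - V_peak m s l > 0"
    using assms(5) zero_le_power2[of \<omega>] by linarith
  then show "4 * \<omega>\<^sup>2 * (\<omega>\<^sup>2 - V_peak m s l) / (2 * \<omega>\<^sup>2 - V_peak m s l)\<^sup>2
         = 1 - (V_peak m s l)\<^sup>2 / (2 * \<omega>\<^sup>2 - V_peak m s l)\<^sup>2"
    by (simp add: divide_simps) (simp add: power2_eq_square algebra_simps)
qed

end
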